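(* For every integer $m\ge 7$, the matrix $\mathbf{A}_m$ (defined in the context) has a single real eigenvalue in the interval $[1.232891-0.0007,\;1.232891+0.0007]$. All remaining (complex) eigenvalues of $\mathbf{A}_m$ have absolute value less than $1.002$.
   Context: The infinite real matrix $\mathbf{A}=(\mathbf{A}_{ij})_{i,j\ge 0}$ has the following entries, where $r,k\ge 1$ are integers and $\binom kr=0$ for $k<r$: $\mathbf{A}_{0,0}=\tfrac12$, $\mathbf{A}_{0,1}=-1$, $\mathbf{A}_{0,j}=0$ for $j\ge 2$; $\mathbf{A}_{1,0}=\tfrac{\pi^2}{12}+\sum_{k\ge1}\tfrac{(-1)^k}{k^2 2^k}-\tfrac{\log 2}{2}$, $\mathbf{A}_{1,1}=\tfrac12+\log 2$, $\mathbf{A}_{1,k+1}=\tfrac1k+\tfrac{(-1)^k}{2^{k+1}}-\tfrac1{k2^k}$; $\mathbf{A}_{r+1,0}=\tfrac{(-1)^r}{r}\sum_{j=r}^\infty \tfrac1{j3^j}$, $\mathbf{A}_{r+1,1}=0$, $\mathbf{A}_{r+1,k+1}=\binom kr\left(\tfrac{(-1)^{k-r}}{2^{k+1}}-\tfrac1{k2^k}\right)$. $\mathbf{A}_m$ denotes the $(m+1)\times(m+1)$ principal submatrix of $\mathbf{A}$ with row and column indices $0,\dots,m$. *)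

theory Defs
  imports Complex_Main "Jordan_Normal_Form.Char_Poly"
begin

text \<open>
  Series are indexed from 0, so the sum over \<open>k \<ge> 1\<close> is written with \<open>Suc k\<close> and the sum over
  \<open>j \<ge> r\<close> with \<open>r + j\<close>. For \<open>k < r\<close> the natural-number subtraction in \<open>(-1) ^ (k - r)\<close> truncates,
  but then the binomial coefficient in front vanishes.
\<close>

definition A_entry :: "nat \<Rightarrow> nat \<Rightarrow> real" where
  "A_entry i j =
    (if i = 0 then
       (if j = 0 then 1 / 2
        else if j = 1 then - 1
        else 0)
     else if i = 1 then
       (if j = 0 then
          pi\<^sup>2 / 12 + (\<Sum>k. (-1) ^ Suc k / ((real (Suc k))\<^sup>2 * 2 ^ Suc k)) - ln 2 / 2
        else if j = 1 then 1 / 2 + ln 2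
        else
          (let k = j - 1
           in 1 / real k + (-1) ^ k / 2 ^ (k + 1) - 1 / (real k * 2 ^ k)))
     else
       (let r = i - 1
        in if j = 0 then (-1) ^ r / real r * (\<Sum>j. 1 / (real (r + j) * 3 ^ (r + j)))
           else if j = 1 then 0
           else
             (let k = j - 1
              in real (k choose r) * ((-1) ^ (k - r) / 2 ^ (k + 1) - 1 / (real k * 2 ^ k)))))"

definition A_sub :: "nat \<Rightarrow> real mat" where
  "A_sub m = mat (m + 1) (m + 1) (\<lambda>(i, j). A_entry i j)"

text \<open>The real matrix regarded as a complex one, so that \<open>eigenvalue\<close> ranges over all complex
  eigenvalues.\<close>

abbreviation A_sub_complex :: "nat \<Rightarrow> complex mat" where
  "A_sub_complex m \<equiv> map_mat complex_of_real (A_sub m)"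

end

theory Submission
  imports Defs "HOL-Analysis.Harmonic_Numbers"
begin

text \<open>
  Below row 1 and right of column 1 the matrix is an upper triangular block \<open>T\<close> whose columns have
  absolute sum at most \<open>1/2\<close>, and besides the leading \<open>2 \<times> 2\<close> corner only the rest \<open>b\<close> of row 1
  and the rest \<open>c\<close> of column 0 are nonzero. For \<open>|z| > 1/2\<close> the row vector \<open>\<beta>(z) = b (z - T)\<^sup>-\<^sup>1\<close>
  has entries that do not depend on \<open>m\<close>, and elimination gives
  \<open>det (z - A\<^sub>m) = f(z) det (z - T)\<close> with
  \<open>f(z) = (z - 1/2)(z - 1/2 - ln 2) + A\<^sub>1\<^sub>0 + \<beta>(z) c\<close>, so that outside the disc of radius \<open>1/2\<close> the
  eigenvalues are the zeros of \<open>f\<close>. As \<open>c\<close> decays like \<open>3\<^sup>-\<^sup>k\<close>, a few terms locate a real zero \<open>l\<close>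
  by a sign change. By the resolvent identity
  \<open>f(z) - f(l) = (z - l)(z + l - 1 - ln 2 - \<beta>(l) (z - T)\<^sup>-\<^sup>1 c)\<close>, and for \<open>|z| \<ge> 1.002\<close> the second
  factor has modulus at least \<open>1/4\<close>; hence \<open>l\<close> is simple and is the only zero there.
\<close>

section \<open>Row systems with an upper triangular matrix\<close>

text \<open>The solution of \<open>x (z - T) = s\<close> for row vectors indexed from 1, by forward substitution; the
  entries of \<open>T\<close> below the diagonal are never read.\<close>

function row_solve :: "(nat \<Rightarrow> nat \<Rightarrow> real) \<Rightarrow> (nat \<Rightarrow> 'a) \<Rightarrow> 'a \<Rightarrow> nat \<Rightarrow> 'a::real_normed_field" where
  "row_solve T s z k =
     (s k + (\<Sum>r=1..<k. row_solve T s z r * of_real (T r k))) / (z - of_real (T k k))"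
  by pat_completeness auto
termination by (relation "measure (\<lambda>(T, s, z, k). k)") auto

declare row_solve.simps [simp del]

lemma row_solve_eq:
  assumes "k \<ge> 1" "z \<noteq> of_real (T k k)"
  shows "z * row_solve T s z k = s k + (\<Sum>r=1..k. row_solve T s z r * of_real (T r k))"
proof -
  have "{1..k} = insert k {1..<k}" using assms(1) by auto
  moreover have "(z - of_real (T k k)) * row_solve T s z k
      = s k + (\<Sum>r=1..<k. row_solve T s z r * of_real (T r k))"
    using assms(2) by (subst row_solve.simps) simp
  ultimately show ?thesis by (simp add: algebra_simps)
qed

text \<open>The equation with index \<open>k\<close> involves only entries up to \<open>k\<close>,
  and its coefficient at \<open>x k\<close> is nonzero, so strong induction fixes the entries one
  after another. This lets identities between solutions be checked on the equations alone.\<close>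

lemma row_solve_unique:
  assumes "\<And>k. k \<ge> 1 \<Longrightarrow> z \<noteq> of_real (T k k)"
    and "\<And>k. k \<ge> 1 \<Longrightarrow> z * x k = s k + (\<Sum>r=1..k. x r * of_real (T r k))"
    and "k \<ge> 1"
  shows "x k = row_solve T s z k"
  using assms(3)
proof (induction k rule: less_induct)
  case (less k)
  have "{1..k} = insert k {1..<k}" using less.prems by auto
  then have "(z - of_real (T k k)) * x k = s k + (\<Sum>r=1..<k. x r * of_real (T r k))"
    using assms(2)[OF less.prems] by (simp add: algebra_simps)
  also have "(\<Sum>r=1..<k. x r * of_real (T r k)) = (\<Sum>r=1..<k. row_solve T s z r * of_real (T r k))"
    using less.IH by (intro sum.cong) auto
  finally show ?case
    using assms(1)[OF less.prems] by (subst row_solve.simps) (simp add: field_simps)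
qed

text \<open>This is the resolvent identity
  \<open>(z - T)^-1 - (w - T)^-1 = (w - z) (w - T)^-1 (z - T)^-1\<close> applied to a row vector.
  The proof shows that the candidate \<open>x\<close> solves the system at \<open>z\<close> and
  invokes uniqueness.\<close>

lemma row_solve_diff:
  assumes "\<And>k. k \<ge> 1 \<Longrightarrow> z \<noteq> of_real (T k k)" "\<And>k. k \<ge> 1 \<Longrightarrow> w \<noteq> of_real (T k k)"
    and "k \<ge> 1"
  shows "row_solve T s z k - row_solve T s w k = (w - z) * row_solve T (row_solve T s w) z k"
proof -
  define x where "x k = row_solve T s w k + (w - z) * row_solve T (row_solve T s w) z k" for k
  have "x k = row_solve T s z k"
  proof (rule row_solve_unique[OF assms(1) _ assms(3)])
    fix k :: nat assume k: "k \<ge> 1"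
    have "z * x k = w * row_solve T s w k + (z - w) * row_solve T s w k
        + (w - z) * (z * row_solve T (row_solve T s w) z k)"
      by (simp add: x_def algebra_simps)
    also have "\<dots> = s k + ((\<Sum>r=1..k. row_solve T s w r * of_real (T r k))
        + (w - z) * (\<Sum>r=1..k. row_solve T (row_solve T s w) z r * of_real (T r k)))"
      by (subst row_solve_eq[of k z T], use k assms(1) in blast, use k assms(1) in blast,
          subst row_solve_eq[of k w T], use k assms(2) in blast, use k assms(2) in blast)
        (simp add: algebra_simps)
    also have "\<dots> = s k + (\<Sum>r=1..k. x r * of_real (T r k))"
      unfolding x_def distrib_right mult.assoc sum.distrib sum_distrib_left ..
    finally show "z * x k = s k + (\<Sum>r=1..k. x r * of_real (T r k))" .
  qed
  then show ?thesis by (simp add: x_def algebra_simps)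
qed

text \<open>This is the maximum norm bound that a Neumann series would give. If earlier entries are
  at most \<open>B = S / (norm z - q)\<close>, the equation for \<open>k\<close> has right-hand side
  at most \<open>S + B * (q - |T k k|) = B * (norm z - |T k k|)\<close>, and dividing by
  \<open>z - T k k\<close> returns \<open>B\<close>. The bound does not depend on
  \<open>k\<close>.\<close>

lemma norm_row_solve_le:
  assumes col: "\<And>k. k \<ge> 1 \<Longrightarrow> (\<Sum>r=1..k. \<bar>T r k\<bar>) \<le> q" and q: "q < norm z"
    and s: "\<And>k. k \<ge> 1 \<Longrightarrow> norm (s k) \<le> S" and k: "k \<ge> 1"
  shows "norm (row_solve T s z k) \<le> S / (norm z - q)"
  using k
proof (induction k rule: less_induct)
  case (less k)
  define B where "B = S / (norm z - q)"
  have S0: "0 \<le> S" using s[of 1] norm_ge_zero[of "s 1"] by linarith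
  have B0: "0 \<le> B" unfolding B_def using S0 q by simp
  have ins: "{1..k} = insert k {1..<k}" using less.prems by auto
  have c: "\<bar>T k k\<bar> + (\<Sum>r=1..<k. \<bar>T r k\<bar>) \<le> q" using col[OF less.prems] unfolding ins by simp
  have c0: "0 \<le> (\<Sum>r=1..<k. \<bar>T r k\<bar>)" by (rule sum_nonneg) simp
  have den: "norm z - \<bar>T k k\<bar> \<le> norm (z - of_real (T k k))"
    by (metis norm_of_real norm_triangle_ineq2)
  have pos: "0 < norm z - \<bar>T k k\<bar>" using c c0 q by linarith
  have "norm (s k + (\<Sum>r=1..<k. row_solve T s z r * of_real (T r k)))
      \<le> S + (\<Sum>r=1..<k. B * \<bar>T r k\<bar>)"
  proof (rule order_trans[OF norm_triangle_ineq], rule add_mono[OF s[OF less.prems]],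
      rule sum_norm_le)
    fix r assume "r \<in> {1..<k}"
    then have "norm (row_solve T s z r) \<le> B" using less.IH[of r] by (auto simp: B_def)
    then show "norm (row_solve T s z r * of_real (T r k)) \<le> B * \<bar>T r k\<bar>"
      by (simp add: norm_mult mult_right_mono)
  qed
  also have "\<dots> = S + B * (\<Sum>r=1..<k. \<bar>T r k\<bar>)" by (simp add: sum_distrib_left)
  also have "\<dots> \<le> S + B * (q - \<bar>T k k\<bar>)" using c B0 by (intro add_left_mono mult_left_mono) auto
  also have "S = B * (norm z - q)" using q by (simp add: B_def)
  also have "B * (norm z - q) + B * (q - \<bar>T k k\<bar>) = B * (norm z - \<bar>T k k\<bar>)"
    by (simp add: algebra_simps)
  also have "\<dots> \<le> B * norm (z - of_real (T k k))" using den B0 by (rule mult_left_mono)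
  finally have le: "norm (s k + (\<Sum>r=1..<k. row_solve T s z r * of_real (T r k)))
      \<le> B * norm (z - of_real (T k k))" .
  have "0 < norm (z - of_real (T k k))" using den pos by linarith
  then have "norm (row_solve T s z k) \<le> B"
    using le by (subst row_solve.simps) (simp add: norm_divide pos_divide_le_eq del: zero_less_norm_iff)
  then show ?case by (simp add: B_def)
qed

lemma row_solve_of_real:
  "row_solve T (\<lambda>k. of_real (s k)) (of_real x) k
     = (of_real (row_solve T s x k) :: 'a::real_normed_field)"
proof (induction k rule: less_induct)
  case (less k)
  have "(\<Sum>r=1..<k. row_solve T (\<lambda>k. of_real (s k)) (of_real x) r * of_real (T r k))
      = (\<Sum>r=1..<k. of_real (row_solve T s x r) * (of_real (T r k) :: 'a))"
    using less.IH by (intro sum.cong) auto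
  then show ?case by (subst (1 2) row_solve.simps) simp
qed

lemma continuous_on_row_solve:
  assumes "\<And>z k. z \<in> D \<Longrightarrow> k \<ge> 1 \<Longrightarrow> z \<noteq> of_real (T k k)" and "k \<ge> 1"
  shows "continuous_on D (\<lambda>z. row_solve T s z k)"
  using assms(2)
proof (induction k rule: less_induct)
  case (less k)
  show ?case
    by (subst row_solve.simps) (use less assms(1) in \<open>auto intro!: continuous_intros\<close>)
qed

section \<open>The characteristic polynomial\<close>

definition A_block :: "nat \<Rightarrow> nat \<Rightarrow> real" where
  "A_block r k = A_entry (Suc r) (Suc k)"

definition A_row :: "nat \<Rightarrow> 'a::real_normed_field" where
  "A_row k = of_real (A_entry 1 (Suc k))"

text \<open>This is \<open>f\<close> of the outline, the determinant of the corner left after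
  elimination; the plus sign before \<open>A_entry 1 0\<close> comes from
  \<open>A_entry 0 1 = -1\<close>. Only the length of the sum depends on \<open>m\<close>. The
  polymorphic type serves both the sign change over the reals and the separation over the complex
  numbers.\<close>

definition secular :: "nat \<Rightarrow> 'a::real_normed_field \<Rightarrow> 'a" where
  "secular m z = (z - of_real (A_entry 0 0)) * (z - of_real (A_entry 1 1)) + of_real (A_entry 1 0)
     + (\<Sum>k=1..<m. row_solve A_block A_row z k * of_real (A_entry (Suc k) 0))"

lemma A_entry_corner: "A_entry 0 0 = 1 / 2" "A_entry (Suc 0) (Suc 0) = 1 / 2 + ln 2"
  by (simp_all add: A_entry_def)

lemma A_block_eq:
  assumes "r \<ge> 1" "k \<ge> 1"
  shows "A_block r k = real (k choose r) * ((-1) ^ (k - r) / 2 ^ (k + 1) - 1 / (real k * 2 ^ k))"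
  using assms by (simp add: A_block_def A_entry_def)

lemma A_block_eq_0:
  assumes "k < r" "k \<ge> 1"
  shows "A_block r k = 0"
  using assms by (simp add: A_block_eq binomial_eq_0)

text \<open>For \<open>k \<ge> 2\<close> one has \<open>1/2 \<ge> 1/k\<close>, so the bracket in
  each entry takes its sign from \<open>(-1) ^ (k - r)\<close> and the absolute values open
  explicitly. The plain and the alternating binomial sums, both without the term
  \<open>r = 0\<close>, then evaluate the column sum exactly. At \<open>k = 1\<close> the sign
  argument fails, but the only entry is \<open>-1/4\<close>.\<close>

lemma A_block_col_sum:
  assumes "k \<ge> 1"
  shows "(\<Sum>r=1..k. \<bar>A_block r k\<bar>) \<le> 1 / 2"
proof (cases "k = 1")
  case True
  then show ?thesis by (simp add: A_block_eq)
next
  case False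
  then have k: "k \<ge> 2" using assms by simp
  have ins: "{..k} = insert 0 {1..k}" by auto
  have e: "\<bar>A_block r k\<bar>
      = (real (k choose r) / 2 - (-1) ^ (k - r) * real (k choose r) / k) / 2 ^ k"
    if "r \<in> {1..k}" for r
  proof -
    have "\<bar>(-1) ^ (k - r) / 2 ^ (k + 1) - 1 / (real k * 2 ^ k)\<bar>
        = (1 / 2 - (-1) ^ (k - r) / k) / 2 ^ k"
    proof (cases "even (k - r)")
      case True
      have "(1::real) / 2 - 1 / k \<ge> 0" using k by (simp add: field_simps)
      moreover have "(1::real) / 2 ^ (k + 1) - 1 / (real k * 2 ^ k) = (1 / 2 - 1 / k) / 2 ^ k"
        using k by (simp add: field_simps)
      ultimately show ?thesis using True by simp
    next
      case False
      have "- (1::real) / 2 ^ (k + 1) - 1 / (real k * 2 ^ k) = - ((1 / 2 + 1 / k) / 2 ^ k)"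
        using k by (simp add: field_simps)
      moreover have "(0::real) \<le> (1 / 2 + 1 / k) / 2 ^ k" by simp
      ultimately show ?thesis using False by simp
    qed
    then have "\<bar>A_block r k\<bar> = real (k choose r) * ((1 / 2 - (-1) ^ (k - r) / k) / 2 ^ k)"
      using that assms by (simp add: A_block_eq abs_mult del: power_Suc)
    then show ?thesis by (simp add: algebra_simps diff_divide_distrib)
  qed
  have "(\<Sum>r\<le>k. real (k choose r)) = 2 ^ k"
    by (metis choose_row_sum of_nat_numeral of_nat_power of_nat_sum)
  then have s1: "(\<Sum>r=1..k. real (k choose r)) = 2 ^ k - 1" by (simp add: ins)
  have "(\<Sum>r\<le>k. (-1) ^ (k - r) * real (k choose r)) = (\<Sum>r\<le>k. (-1) ^ r * real (k choose r))"
    by (rule sum.reindex_bij_witness[of _ "\<lambda>r. k - r" "\<lambda>r. k - r"])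
       (auto simp: binomial_symmetric[symmetric])
  also have "\<dots> = 0" using assms by (intro choose_alternating_sum) auto
  finally have s2: "(\<Sum>r=1..k. (-1) ^ (k - r) * real (k choose r)) = - ((-1) ^ k)"
    by (simp add: ins)
  have "(\<Sum>r=1..k. \<bar>A_block r k\<bar>) = (\<Sum>r=1..k. (real (k choose r) / 2 - (-1) ^ (k - r) * real (k choose r) / k) / 2 ^ k)"
    using e by (rule sum.cong[OF refl])
  also have "\<dots> = ((2 ^ k - 1) / 2 + (-1) ^ k / k) / 2 ^ k"
    unfolding sum_divide_distrib[symmetric] sum_subtractf s1 s2 by simp
  also have "\<dots> \<le> ((2 ^ k - 1) / 2 + 1 / 2) / 2 ^ k"
  proof -
    have "(-1) ^ k / real k \<le> 1 / real k" by (cases "even k") (auto simp: field_simps)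
    also have "\<dots> \<le> 1 / 2" using k by (simp add: field_simps)
    finally show ?thesis by (intro divide_right_mono add_left_mono) auto
  qed
  also have "\<dots> = 1 / 2" by (simp add: field_simps)
  finally show ?thesis .
qed

lemma abs_A_block_diag_le:
  assumes "k \<ge> 1"
  shows "\<bar>A_block k k\<bar> \<le> 1 / 2"
proof -
  have "\<bar>A_block k k\<bar> \<le> (\<Sum>r=1..k. \<bar>A_block r k\<bar>)"
    using assms by (intro member_le_sum) auto
  then show ?thesis using A_block_col_sum[OF assms] by linarith
qed

lemma A_block_diag_neq:
  fixes z :: "'a::real_normed_field"
  assumes "norm z > 1 / 2" "k \<ge> 1"
  shows "z \<noteq> of_real (A_block k k)"
  using assms(1) abs_A_block_diag_le[OF assms(2)] norm_of_real[of "A_block k k", where 'a = 'a]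
  by auto

lemma norm_A_row_le:
  assumes "k \<ge> 1"
  shows "norm (A_row k :: 'a::real_normed_field) \<le> 1 / 2"
proof -
  have *: "A_entry 1 (Suc k) = 1 / real k + (-1) ^ k / 2 ^ (k + 1) - 1 / (real k * 2 ^ k)"
    using assms by (simp add: A_entry_def)
  \<comment> \<open>The bound \<open>1/2\<close> is attained at \<open>k = 2\<close> through a
    cancellation, so the first two entries are evaluated exactly. From 3 on, the crude sum
    \<open>1/3 + 1/16 + 1/24\<close> suffices.\<close>
  consider "k = 1" | "k = 2" | "k \<ge> 3" using assms by linarith
  then have "\<bar>A_entry 1 (Suc k)\<bar> \<le> 1 / 2"
  proof cases
    case 3
    have p: "(2::real) ^ k \<ge> 2 ^ 3" using 3 by (intro power_increasing) auto
    have "3 * 8 \<le> real k * 2 ^ k" using 3 p by (intro mult_mono) auto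
    then have "(0::real) \<le> 1 / (real k * 2 ^ k)" "1 / (real k * 2 ^ k) \<le> 1 / 24"
      using 3 by (auto simp: field_simps)
    moreover have "\<bar>(-1) ^ k / 2 ^ (k + 1) :: real\<bar> \<le> 1 / 16"
      using p by (simp add: abs_mult power_abs field_simps)
    moreover have "0 \<le> 1 / real k" "1 / real k \<le> 1 / 3" using 3 by (auto simp: field_simps)
    ultimately show ?thesis unfolding * by linarith
  qed (unfold *, auto)
  then show ?thesis by (simp add: A_row_def)
qed

text \<open>Adding \<open>\<beta>(z)\<close> times the lower rows to row 1 of \<open>z - A\<^sub>m\<close> clears the upper right block.\<close>

lemma char_poly_A_sub:
  fixes z :: complex
  assumes z: "norm z > 1 / 2" and m: "m \<ge> 1"
  shows "poly (char_poly (A_sub_complex m)) z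
    = secular m z * (\<Prod>k=1..<m. z - of_real (A_block k k))"
proof -
  define x where "x = row_solve A_block A_row z"
  define n where "n = m - 1"
  have mn: "Suc m = 2 + n" using m by (simp add: n_def)
  \<comment> \<open>\<open>char_matrix\<close> is the matrix minus \<open>z\<close> on the diagonal,
    so \<open>M\<close> is \<open>z - A\<close>.\<close>
  define M where "M = - char_matrix (A_sub_complex m) z"
  \<comment> \<open>The lower rows start at matrix index 2 while \<open>x\<close> is indexed from 1,
    hence \<open>x (j - 1)\<close>.\<close>
  define U where "U = Matrix.mat (2 + n) (2 + n) (\<lambda>(i, j). if i = j then 1 else if i = 1 \<and> j \<ge> 2 then x (j - 1) else 0)"
  define P where "P = Matrix.mat 2 2 (\<lambda>(i, j). if i = 0 then (if j = 0 then z - 1 / 2 else 1)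
    else if j = 0 then - of_real (A_entry 1 0) - (\<Sum>k=1..<m. x k * of_real (A_entry (Suc k) 0))
    else z - of_real (A_entry 1 1))"
  define C where "C = Matrix.mat n 2 (\<lambda>(i, j). - of_real (A_entry (i + 2) j) :: complex)"
  define D where "D = Matrix.mat n n (\<lambda>(i, j). (if i = j then z else 0) - of_real (A_block (Suc i) (Suc j)))"
  have A: "A_sub_complex m \<in> carrier_mat (2 + n) (2 + n)" unfolding mn[symmetric] by (auto simp: A_sub_def)
  have Mc: "M \<in> carrier_mat (2 + n) (2 + n)" using A by (auto simp: M_def char_matrix_def)
  have Uc: "U \<in> carrier_mat (2 + n) (2 + n)" by (simp add: U_def)
  have Mij: "M $$ (i, j) = (if i = j then z else 0) - of_real (A_entry i j)"
    if "i < 2 + n" "j < 2 + n" for i j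
    using that A by (auto simp: M_def char_matrix_def A_sub_def mn)
  have "det U = prod_list (diag_mat U)"
    by (rule det_upper_triangular[OF upper_triangularI Uc]) (auto simp: U_def)
  also have "\<dots> = 1" by (auto simp: U_def diag_mat_def intro!: prod_list_neutral)
  finally have detU: "det U = 1" .
  have UM: "(U * M) $$ (i, j) = (\<Sum>l<2+n. U $$ (i, l) * M $$ (l, j))"
    if "i < 2 + n" "j < 2 + n" for i j
    using that Uc Mc by (simp add: scalar_prod_def atLeast0LessThan)
  have UM_other: "(U * M) $$ (i, j) = M $$ (i, j)" if "i < 2 + n" "j < 2 + n" "i \<noteq> 1" for i j
  proof -
    have "(U * M) $$ (i, j) = (\<Sum>l<2+n. if l = i then M $$ (l, j) else 0)"
      unfolding UM[OF that(1,2)] using that by (intro sum.cong) (auto simp: U_def)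
    then show ?thesis using that by simp
  qed
  have UM_1: "(U * M) $$ (1, j) = M $$ (1, j) + (\<Sum>k=1..<m. x k * M $$ (Suc k, j))"
    if "j < 2 + n" for j
  proof -
    have mS: "m = Suc n" using mn by simp
    have "sum f {..<2+n} = f 0 + (f 1 + (\<Sum>k=1..<m. f (Suc k)))" for f :: "nat \<Rightarrow> complex"
      unfolding mS by (simp add: sum.lessThan_Suc_shift lessThan_atLeast0[of n]
          sum.shift_bounds_Suc_ivl del: sum.lessThan_Suc sum.op_ivl_Suc)
    then have "(U * M) $$ (1, j) = U $$ (1, 0) * M $$ (0, j) + (U $$ (1, 1) * M $$ (1, j)
        + (\<Sum>k=1..<m. U $$ (1, Suc k) * M $$ (Suc k, j)))"
      using UM[of 1 j] that by simp
    also have "\<dots> = M $$ (1, j) + (\<Sum>k=1..<m. x k * M $$ (Suc k, j))"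
      by (auto simp: U_def mS intro!: sum.cong)
    finally show ?thesis .
  qed
  \<comment> \<open>The row operation sums over all lower rows, whereas \<open>row_solve_eq\<close>
    stops at the diagonal; the zeros of the block below its diagonal reconcile the two.\<close>
  have tri: "(\<Sum>k=1..<m. x k * of_real (A_block k l)) = (\<Sum>k=1..l. x k * of_real (A_block k l))"
    if "1 \<le> l" "l < m" for l
    using that A_block_eq_0 by (intro sum.mono_neutral_right) auto
  have "U * M = four_block_mat P (0\<^sub>m 2 n) C D"
  proof (rule eq_matI)
    fix i j assume "i < dim_row (four_block_mat P (0\<^sub>m 2 n) C D)"
      "j < dim_col (four_block_mat P (0\<^sub>m 2 n) C D)"
    then have ij: "i < 2 + n" "j < 2 + n" by (auto simp: P_def D_def)
    show "(U * M) $$ (i, j) = four_block_mat P (0\<^sub>m 2 n) C D $$ (i, j)"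
    proof (cases "i = 1")
      case False
      then have "i = 0 \<or> i \<ge> 2" by linarith
      then show ?thesis using UM_other[OF ij False] ij
        by (auto simp: Mij P_def C_def D_def A_block_def A_entry_def[of 0] Suc_diff_Suc numeral_2_eq_2)
    next
      case i: True
      consider "j = 0" | "j = 1" | l where "j = Suc l" "1 \<le> l" "l < m"
        using ij mn by (cases j) force+
      then show ?thesis
      proof cases
        case 1
        have "(\<Sum>k=1..<m. x k * M $$ (Suc k, 0)) = (\<Sum>k=1..<m. x k * - of_real (A_entry (Suc k) 0))"
          using mn by (intro sum.cong) (auto simp: Mij)
        then show ?thesis using UM_1[OF ij(2)] i 1 by (auto simp: Mij P_def sum_negf)
      next
        case 2
        have "(\<Sum>k=1..<m. x k * M $$ (Suc k, 1)) = (\<Sum>k=1..<m. 0)"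
          using mn by (intro sum.cong) (auto simp: Mij A_entry_def)
        then show ?thesis using UM_1[OF ij(2)] i 2 by (auto simp: Mij P_def)
      next
        case 3
        \<comment> \<open>By the defining system of \<open>x\<close>, the added contribution in this
          column is \<open>A_row l\<close>, which cancels the entry \<open>- A_row l\<close> of
          \<open>M\<close> in row 1.\<close>
        have "(\<Sum>k=1..<m. x k * M $$ (Suc k, j))
            = (\<Sum>k=1..<m. (if k = l then x l * z else 0) - x k * of_real (A_block k l))"
          using mn 3 by (intro sum.cong) (auto simp: Mij A_block_def algebra_simps)
        also have "\<dots> = z * x l - (\<Sum>k=1..l. x k * of_real (A_block k l))"
          using 3 tri[of l] by (simp add: sum_subtractf)
        also have "\<dots> = A_row l"
          unfolding x_def using row_solve_eq[of l z A_block A_row] A_block_diag_neq[OF z 3(2)] 3(2) by simp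
        finally show ?thesis using UM_1[OF ij(2)] i 3 ij by (auto simp: Mij P_def D_def A_row_def)
      qed
    qed
  qed (use Uc Mc in \<open>auto simp: P_def D_def\<close>)
  then have "det (U * M) = det P * det D"
    using det_four_block_mat_upper_right_zero[of P 2 "0\<^sub>m 2 n" n C D]
    by (simp add: P_def C_def D_def)
  then have "det M = det P * det D" using det_mult[OF Uc Mc] detU by simp
  moreover have "det P = secular m z"
  proof -
    have "det P = P $$ (0, 0) * P $$ (1, 1) - P $$ (0, 1) * P $$ (1, 0)"
      by (subst laplace_expansion_row[of P 2 0])
         (auto simp: P_def cofactor_def mat_delete_def det_single numeral_2_eq_2)
    then show ?thesis by (simp add: P_def secular_def x_def A_entry_corner)
  qed
  moreover have "det D = (\<Prod>k=1..<m. z - of_real (A_block k k))"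
  proof -
    have "det D = prod_list (diag_mat D)"
      by (rule det_upper_triangular[of _ n], rule upper_triangularI) (auto simp: D_def A_block_eq_0)
    also have "\<dots> = (\<Prod>i=0..<n. z - of_real (A_block (Suc i) (Suc i)))"
      by (auto simp: diag_mat_def D_def prod.list_conv_set_nth intro!: prod.cong)
    also have "\<dots> = (\<Prod>k=1..<m. z - of_real (A_block k k))"
      using prod.shift_bounds_Suc_ivl[of "\<lambda>k. z - of_real (A_block k k)" 0 n] m
      by (simp add: n_def)
    finally show ?thesis .
  qed
  ultimately show ?thesis using char_poly_matrix[OF A] by (simp add: M_def)
qed

section \<open>Estimates for the entries\<close>

definition third_tail :: "nat \<Rightarrow> real" where
  "third_tail r = (\<Sum>j. 1 / (real (r + j) * 3 ^ (r + j)))"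

text \<open>Replacing \<open>1 / (r + j)\<close> by \<open>1 / r\<close> leaves a geometric series
  of ratio \<open>1/3\<close>, whose sum contributes the factor \<open>3/2\<close>.\<close>

lemma
  assumes "r \<ge> 1"
  shows third_tail_summable: "summable (\<lambda>j. 1 / (real (r + j) * 3 ^ (r + j)))"
    and third_tail_le: "third_tail r \<le> 3 / (2 * real r * 3 ^ r)"
proof -
  have g: "(\<lambda>j. 1 / (real r * 3 ^ r) * (1 / 3) ^ j) sums (1 / (real r * 3 ^ r) * (1 / (1 - 1 / 3)))"
    by (intro sums_mult geometric_sums) simp
  have le: "1 / (real (r + j) * 3 ^ (r + j)) \<le> 1 / (real r * 3 ^ r) * (1 / 3) ^ j" for j
  proof -
    have "1 / (real (r + j) * 3 ^ (r + j)) \<le> 1 / (real r * 3 ^ (r + j))"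
      using assms by (intro divide_left_mono mult_right_mono) auto
    then show ?thesis by (simp add: power_add power_one_over mult.assoc)
  qed
  show s: "summable (\<lambda>j. 1 / (real (r + j) * 3 ^ (r + j)))"
    by (rule summable_comparison_test'[OF sums_summable[OF g], of 0]) (use le in auto)
  have "third_tail r \<le> (\<Sum>j. 1 / (real r * 3 ^ r) * (1 / 3) ^ j)"
    unfolding third_tail_def by (intro suminf_le le s sums_summable[OF g])
  also have "\<dots> = 3 / (2 * real r * 3 ^ r)" using sums_unique[OF g] by simp
  finally show "third_tail r \<le> 3 / (2 * real r * 3 ^ r)" .
qed

lemma third_tail_nonneg: "r \<ge> 1 \<Longrightarrow> 0 \<le> third_tail r"
  unfolding third_tail_def by (intro suminf_nonneg third_tail_summable) auto

lemma third_tail_rec: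
  assumes "r \<ge> 1"
  shows "third_tail r = 1 / (real r * 3 ^ r) + third_tail (Suc r)"
  using suminf_split_head[OF third_tail_summable[OF assms]]
  by (simp add: third_tail_def)

lemma A_entry_first_col:
  assumes "r \<ge> 1"
  shows "A_entry (Suc r) 0 = (-1) ^ r / real r * third_tail r"
  using assms by (simp add: A_entry_def third_tail_def)

lemma abs_A_entry_first_col_le:
  assumes "r \<ge> 1"
  shows "\<bar>A_entry (Suc r) 0\<bar> \<le> 3 / (2 * (real r)\<^sup>2 * 3 ^ r)"
proof -
  have "\<bar>A_entry (Suc r) 0\<bar> = third_tail r / real r"
    using third_tail_nonneg[OF assms] by (simp add: A_entry_first_col[OF assms] abs_mult)
  also have "\<dots> \<le> (3 / (2 * real r * 3 ^ r)) / real r"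
    by (intro divide_right_mono third_tail_le assms) auto
  finally show ?thesis by (simp add: power2_eq_square mult_ac)
qed

text \<open>The factor \<open>9/4\<close> is \<open>3/2\<close> twice: once from the series inside
  each entry, once from summing the entries, with \<open>1 / k^2\<close> replaced by
  \<open>1 / n^2\<close>.\<close>

lemma sum_abs_A_entry_first_col_le:
  assumes "n \<ge> 1"
  shows "(\<Sum>k=n..<m. \<bar>A_entry (Suc k) 0\<bar>) \<le> 9 / (4 * (real n)\<^sup>2 * 3 ^ n)"
proof -
  have geo: "(\<Sum>k=n..<m. (1 / 3 :: real) ^ k) \<le> 3 / 2 * (1 / 3) ^ n"
  proof (cases "n \<le> m")
    case True
    then have "(\<Sum>k=n..<m. (1 / 3 :: real) ^ k) = 3 / 2 * ((1 / 3) ^ n - (1 / 3) ^ m)"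
      by (induction rule: dec_induct) auto
    then show ?thesis by simp
  qed auto
  have "(\<Sum>k=n..<m. \<bar>A_entry (Suc k) 0\<bar>) \<le> (\<Sum>k=n..<m. 3 / (2 * (real n)\<^sup>2) * (1 / 3) ^ k)"
  proof (rule sum_mono)
    fix k assume k: "k \<in> {n..<m}"
    then have "\<bar>A_entry (Suc k) 0\<bar> \<le> 3 / (2 * (real k)\<^sup>2 * 3 ^ k)"
      using assms by (intro abs_A_entry_first_col_le) auto
    also have "\<dots> \<le> 3 / (2 * (real n)\<^sup>2 * 3 ^ k)"
      using k assms by (intro divide_left_mono mult_right_mono mult_left_mono power_mono) auto
    finally show "\<bar>A_entry (Suc k) 0\<bar> \<le> 3 / (2 * (real n)\<^sup>2) * (1 / 3) ^ k"
      by (simp add: power_one_over)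
  qed
  also have "\<dots> \<le> 3 / (2 * (real n)\<^sup>2) * (3 / 2 * (1 / 3) ^ n)"
    unfolding sum_distrib_left[symmetric] using geo by (intro mult_left_mono) auto
  finally show ?thesis by (simp add: power_one_over mult_ac)
qed

lemma norm_sum_row_first_col_le:
  fixes x :: "nat \<Rightarrow> 'a::real_normed_field"
  assumes "n \<ge> 1" "B \<ge> 0" "\<And>k. k \<ge> n \<Longrightarrow> norm (x k) \<le> B"
  shows "norm (\<Sum>k=n..<m. x k * of_real (A_entry (Suc k) 0)) \<le> B * (9 / (4 * (real n)\<^sup>2 * 3 ^ n))"
proof -
  have "norm (\<Sum>k=n..<m. x k * of_real (A_entry (Suc k) 0)) \<le> (\<Sum>k=n..<m. B * \<bar>A_entry (Suc k) 0\<bar>)"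
    using assms(3) by (intro sum_norm_le) (auto simp: norm_mult intro!: mult_right_mono)
  also have "\<dots> \<le> B * (9 / (4 * (real n)\<^sup>2 * 3 ^ n))"
    unfolding sum_distrib_left[symmetric]
    by (intro mult_left_mono sum_abs_A_entry_first_col_le assms)
  finally show ?thesis .
qed

lemma norm_row_solve_A_le:
  assumes "norm z > 1 / 2" "\<And>k. k \<ge> 1 \<Longrightarrow> norm (s k) \<le> S" "k \<ge> 1"
  shows "norm (row_solve A_block s z k) \<le> S / (norm z - 1 / 2)"
  using assms by (intro norm_row_solve_le A_block_col_sum) auto

section \<open>Numerical enclosures of the constants and of the leading entries\<close>

lemma ln2_bounds: "0.693146 \<le> ln (2::real)" "ln (2::real) \<le> 0.693149"
  using ln_approx_bounds[of 2 5] by (simp_all add: eval_nat_numeral)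

text \<open>The series is the dilogarithm at \<open>-1/2\<close>.\<close>

lemma dilog_bounds:
  defines "S \<equiv> (\<Sum>k. (-1) ^ Suc k / ((real (Suc k))\<^sup>2 * 2 ^ Suc k))"
  shows "-0.44843 \<le> S" "S \<le> -0.44840"
proof -
  let ?f = "\<lambda>k. (-1) ^ Suc k / ((real (Suc k))\<^sup>2 * 2 ^ Suc k)"
  have g: "(\<lambda>k. 1 / (121 * 2 ^ 11) * (1 / 2 :: real) ^ k) sums (1 / (121 * 2 ^ 11) * (1 / (1 - 1 / 2)))"
    by (intro sums_mult geometric_sums) simp
  \<comment> \<open>After ten terms the remainder is dominated by a geometric series of ratio
    \<open>1/2\<close> starting at \<open>1 / (121 * 2^11)\<close>. Its sum is below
    \<open>0.00001\<close>, the slack between the bounds for the partial sum and those claimed for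
    \<open>S\<close>.\<close>
  have le: "norm (?f (k + 10)) \<le> 1 / (121 * 2 ^ 11) * (1 / 2) ^ k" for k
  proof -
    have "norm (?f (k + 10)) = 1 / ((real (k + 11))\<^sup>2 * 2 ^ (k + 11))"
      by (simp add: norm_mult norm_power norm_divide add.commute)
    also have "\<dots> \<le> 1 / (11\<^sup>2 * 2 ^ (k + 11))"
      by (intro divide_left_mono mult_right_mono power_mono) auto
    finally show ?thesis by (simp add: power_add power_one_over)
  qed
  have s10: "summable (\<lambda>k. ?f (k + 10))"
    by (rule summable_comparison_test'[OF sums_summable[OF g], of 0]) (use le in blast)
  then have s: "summable ?f" by (rule iffD1[OF summable_iff_shift])
  have "norm (\<Sum>k. ?f (k + 10)) \<le> (\<Sum>k. 1 / (121 * 2 ^ 11) * (1 / 2) ^ k)"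
    by (rule norm_suminf_le[OF le sums_summable[OF g]])
  also have "\<dots> = 1 / (121 * 2 ^ 10)" using sums_unique[OF g] by simp
  finally have t: "\<bar>\<Sum>k. ?f (k + 10)\<bar> \<le> 1 / (121 * 2 ^ 10)" by simp
  have "S = (\<Sum>k. ?f (k + 10)) + (\<Sum>k<10. ?f k)"
    unfolding S_def by (rule suminf_split_initial_segment[OF s])
  moreover have "-0.44842 \<le> (\<Sum>k<10. ?f k)" "(\<Sum>k<10. ?f k) \<le> -0.44841"
    by (simp_all add: eval_nat_numeral)
  ultimately show "-0.44843 \<le> S" "S \<le> -0.44840" using t by (simp_all add: abs_le_iff)
qed

lemma A_entry_1_0_bounds: "0.02746 \<le> A_entry 1 0" "A_entry 1 0 \<le> 0.02750"
proof -
  have "3.141592^2 \<le> pi\<^sup>2" "pi\<^sup>2 \<le> 3.141593^2"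
    using pi_approx by (auto intro!: power_mono)
  then show "0.02746 \<le> A_entry 1 0" "A_entry 1 0 \<le> 0.02750"
    using ln2_bounds dilog_bounds by (simp_all add: A_entry_def power2_eq_square)
qed

text \<open>Here \<open>third_tail 1 = ln (3/2)\<close>.\<close>

lemma third_tail_1_bounds: "0.405455 \<le> third_tail 1" "third_tail 1 \<le> 0.405469"
proof -
  \<comment> \<open>The fraction is the sum of the first eight terms of the series.\<close>
  have "third_tail 1 = 744857 / 1837080 + third_tail 9"
    using third_tail_rec[of 1] third_tail_rec[of 2] third_tail_rec[of 3] third_tail_rec[of 4]
      third_tail_rec[of 5] third_tail_rec[of 6] third_tail_rec[of 7] third_tail_rec[of 8]
    by (simp add: eval_nat_numeral)
  moreover have "0 \<le> third_tail 9" "third_tail 9 \<le> 1 / 118098"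
    using third_tail_nonneg[of 9] third_tail_le[of 9] by simp_all
  ultimately show "0.405455 \<le> third_tail 1" "third_tail 1 \<le> 0.405469" by simp_all
qed

text \<open>Peeling off terms of the series leaves \<open>third_tail 1\<close> as the only
  irrational quantity, so the later sign tests are linear in it and one enclosure serves all four
  entries.\<close>

lemma A_entry_first_col_small:
  "A_entry 2 0 = - third_tail 1"
  "A_entry 3 0 = (third_tail 1 - 1 / 3) / 2"
  "A_entry 4 0 = - (third_tail 1 - 7 / 18) / 3"
  "A_entry 5 0 = (third_tail 1 - 65 / 162) / 4"
proof -
  have t: "third_tail 2 = third_tail 1 - 1 / 3" "third_tail 3 = third_tail 1 - 7 / 18"
    "third_tail 4 = third_tail 1 - 65 / 162"
    using third_tail_rec[of 1] third_tail_rec[of 2] third_tail_rec[of 3]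
    by (simp_all add: eval_nat_numeral)
  show "A_entry 2 0 = - third_tail 1" "A_entry 3 0 = (third_tail 1 - 1 / 3) / 2"
    "A_entry 4 0 = - (third_tail 1 - 7 / 18) / 3" "A_entry 5 0 = (third_tail 1 - 65 / 162) / 4"
    using A_entry_first_col[of 1] A_entry_first_col[of 2] A_entry_first_col[of 3] A_entry_first_col[of 4]
    unfolding t by (simp_all add: eval_nat_numeral diff_divide_distrib)
qed

lemma row_solve_A_small:
  fixes x :: real
  assumes "x > 1 / 2"
  defines "y \<equiv> row_solve A_block A_row x"
  shows "y 1 = 1 / (4 * x + 1)" "y 2 = 2 / (4 * x + 1)"
    "y 3 = (11 / 48 - 9 / (16 * (4 * x + 1))) / (x - 1 / 48)"
    "y 4 = (17 / 64 - 3 / 16 * y 3) / (x - 1 / 64)"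
proof -
  have T: "A_block (Suc 0) (Suc 0) = - (1 / 4)" "A_block (Suc 0) 2 = - (1 / 2)" "A_block 2 2 = 0" "A_block (Suc 0) 3 = 1 / 16"
    "A_block 2 3 = - (5 / 16)" "A_block 3 3 = 1 / 48" "A_block (Suc 0) 4 = - (3 / 16)" "A_block 2 4 = 3 / 32"
    "A_block 3 4 = - (3 / 16)" "A_block 4 4 = 1 / 64"
    by (simp_all add: A_block_eq eval_nat_numeral)
  have b: "A_row 1 = (1 / 4 :: real)" "A_row 2 = (1 / 2 :: real)" "A_row 3 = (11 / 48 :: real)"
    "A_row 4 = (17 / 64 :: real)"
    by (simp_all add: A_row_def A_entry_def)
  have i: "{1..<1::nat} = {}" "{1..<2::nat} = {1}" "{1..<3::nat} = {1, 2}" "{1..<4::nat} = {1, 2, 3}"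
    by auto
  note y = row_solve.simps[of A_block A_row x, folded y_def]
  show y1: "y 1 = 1 / (4 * x + 1)"
    using assms(1) unfolding y[of 1] b i by (simp add: T field_simps)
  have nz: "x \<noteq> 0" "4 * x + 1 \<noteq> 0" using assms(1) by auto
  have "y 2 = (1 / 2 - y 1 / 2) / x" unfolding y[of 2] b i by (simp add: T)
  also have "\<dots> = 2 / (4 * x + 1)" unfolding y1 using nz by (simp add: divide_simps)
  finally show y2: "y 2 = 2 / (4 * x + 1)" .
  \<comment> \<open>Because of this ratio the contributions of \<open>y 1\<close> and
    \<open>y 2\<close> to the equation for \<open>y 4\<close> cancel.\<close>
  have y21: "y 2 = 2 * y 1" unfolding y1 y2 by simp
  have "y 3 = (11 / 48 + y 1 / 16 - 5 / 16 * y 2) / (x - 1 / 48)"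
    unfolding y[of 3] b i by (simp add: T)
  also have "11 / 48 + y 1 / 16 - 5 / 16 * y 2 = 11 / 48 - 9 / 16 * y 1"
    unfolding y21 by simp
  also have "9 / 16 * y 1 = 9 / (16 * (4 * x + 1))" unfolding y1 by simp
  finally show "y 3 = (11 / 48 - 9 / (16 * (4 * x + 1))) / (x - 1 / 48)" .
  have "y 4 = (17 / 64 - 3 / 16 * y 1 + 3 / 32 * y 2 - 3 / 16 * y 3) / (x - 1 / 64)"
    unfolding y[of 4] b i by (simp add: T)
  then show "y 4 = (17 / 64 - 3 / 16 * y 3) / (x - 1 / 64)" unfolding y21 by simp
qed

section \<open>Roots of the secular function\<close>

text \<open>Four explicit terms are enough: for \<open>k \<ge> 5\<close> the solution is at most
  \<open>0.7\<close> and column 0 sums to at most \<open>9 / (4 * 25 * 243)\<close>, which together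
  stay below \<open>0.0003\<close>. At the two ends of the interval around \<open>1.232891\<close>
  the explicit part is more than \<open>0.0005\<close> away from zero, with opposite signs.\<close>

lemma secular_approx:
  fixes x :: real
  assumes m: "m \<ge> 7" and x: "x \<ge> 1.23"
  defines "y \<equiv> row_solve A_block A_row x"
  shows "\<bar>secular m x - ((x - 1 / 2) * (x - 1 / 2 - ln 2) + A_entry 1 0 + y 1 * A_entry 2 0
    + y 2 * A_entry 3 0 + y 3 * A_entry 4 0 + y 4 * A_entry 5 0)\<bar> \<le> 0.0003"
proof -
  have le: "norm (\<Sum>k=5..<m. y k * of_real (A_entry (Suc k) 0)) \<le> 0.7 * (9 / (4 * (real 5)\<^sup>2 * 3 ^ 5))"
  proof (rule norm_sum_row_first_col_le)
    fix k :: nat assume "k \<ge> 5"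
    then have "norm (y k) \<le> (1 / 2) / (norm x - 1 / 2)"
      unfolding y_def using x by (intro norm_row_solve_A_le norm_A_row_le) auto
    also have "\<dots> \<le> 0.7" using x by (simp add: field_simps)
    finally show "norm (y k) \<le> 0.7" .
  qed auto
  have "(\<Sum>k=1..<m. y k * of_real (A_entry (Suc k) 0))
      = (\<Sum>k=1..<5. y k * A_entry (Suc k) 0) + (\<Sum>k=5..<m. y k * of_real (A_entry (Suc k) 0))"
    using m sum.atLeastLessThan_concat[of 1 5 m "\<lambda>k. y k * A_entry (Suc k) 0"] by simp
  moreover have "(\<Sum>k=1..<5. y k * A_entry (Suc k) 0)
      = y 1 * A_entry 2 0 + y 2 * A_entry 3 0 + y 3 * A_entry 4 0 + y 4 * A_entry 5 0"
    by (simp add: eval_nat_numeral)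
  ultimately show ?thesis
    using le by (simp add: secular_def y_def[symmetric] A_entry_corner diff_diff_eq)
qed

lemma secular_neg: "m \<ge> 7 \<Longrightarrow> secular m (1.232891 - 0.0007 :: real) < 0"
  using secular_approx[of m "1.232891 - 0.0007", THEN abs_le_D1] ln2_bounds A_entry_1_0_bounds third_tail_1_bounds
  by (simp add: row_solve_A_small[simplified] A_entry_first_col_small add_divide_distrib diff_divide_distrib)

lemma secular_pos: "m \<ge> 7 \<Longrightarrow> secular m (1.232891 + 0.0007 :: real) > 0"
  using secular_approx[of m "1.232891 + 0.0007", THEN abs_le_D2] ln2_bounds A_entry_1_0_bounds third_tail_1_bounds
  by (simp add: row_solve_A_small[simplified] A_entry_first_col_small add_divide_distrib diff_divide_distrib)

lemma row_solve_A_of_real: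
  "row_solve A_block A_row (of_real x) k
     = (of_real (row_solve A_block A_row x k) :: 'a::real_normed_field)"
proof -
  have "(\<lambda>k. of_real (A_row k :: real)) = (A_row :: nat \<Rightarrow> 'a)"
    by (rule ext) (simp add: A_row_def)
  then show ?thesis
    using row_solve_of_real[of A_block "A_row :: nat \<Rightarrow> real" x k, where 'a = 'a] by simp
qed

lemma secular_of_real: "secular m (of_real x) = (of_real (secular m x) :: 'a::real_normed_field)"
  by (simp add: secular_def row_solve_A_of_real)

lemma secular_root:
  assumes "m \<ge> 7"
  obtains l :: real where "l \<in> {1.232891 - 0.0007 .. 1.232891 + 0.0007}" "secular m l = 0"
proof -
  have "continuous_on {1.232891 - 0.0007 .. 1.232891 + 0.0007 :: real} (secular m)"
    unfolding secular_def
    by (intro continuous_intros continuous_on_row_solve A_block_diag_neq) auto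
  then obtain l :: real where "1.232891 - 0.0007 \<le> l" "l \<le> 1.232891 + 0.0007" "secular m l = 0"
    using IVT'[of "secular m :: real \<Rightarrow> real" "1.232891 - 0.0007" 0 "1.232891 + 0.0007"]
      secular_neg[OF assms] secular_pos[OF assms] by auto
  then show ?thesis using that by auto
qed

text \<open>The resolvent identity extracts the factor \<open>z - l\<close>. The cofactor is at
  least \<open>norm z - |l - 1 - ln 2| - norm G\<close>, hence at least
  \<open>1.002 - 0.47 - 0.2\<close>, which exceeds \<open>1/4\<close>. A bound linear in the
  distance to \<open>l\<close> yields simplicity as well as uniqueness.\<close>

lemma secular_separation:
  fixes z :: complex
  assumes z: "norm z \<ge> 1.002" and l: "l \<in> {1.232891 - 0.0007 .. 1.232891 + 0.0007}" and m: "m \<ge> 2"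
  shows "norm (secular m z - secular m (complex_of_real l)) \<ge> 1 / 4 * norm (z - of_real l)"
proof -
  define w where "w = complex_of_real l"
  define y where "y = row_solve A_block A_row w"
  define g where "g = row_solve A_block y z"
  define G where "G = (\<Sum>k=1..<m. g k * of_real (A_entry (Suc k) 0))"
  have lw: "norm w = l" using l by (simp add: w_def)
  have dz: "k \<ge> 1 \<Longrightarrow> z \<noteq> of_real (A_block k k)" and dw: "k \<ge> 1 \<Longrightarrow> w \<noteq> of_real (A_block k k)" for k
    using z l lw A_block_diag_neq[of z k] A_block_diag_neq[of w k] by simp_all
  have "(\<Sum>k=1..<m. row_solve A_block A_row z k * of_real (A_entry (Suc k) 0))
      - (\<Sum>k=1..<m. y k * of_real (A_entry (Suc k) 0))
      = (\<Sum>k=1..<m. (w - z) * (g k * of_real (A_entry (Suc k) 0)))"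
    unfolding sum_subtractf[symmetric]
  proof (rule sum.cong[OF refl])
    fix k assume "k \<in> {1..<m}"
    then have "row_solve A_block A_row z k - y k = (w - z) * g k"
      unfolding y_def g_def by (intro row_solve_diff dz dw) auto
    then show "row_solve A_block A_row z k * of_real (A_entry (Suc k) 0) - y k * of_real (A_entry (Suc k) 0)
        = (w - z) * (g k * of_real (A_entry (Suc k) 0))"
      by (metis left_diff_distrib mult.assoc)
  qed
  also have "\<dots> = (w - z) * G" by (simp add: G_def sum_distrib_left)
  finally have "secular m z - secular m w = (z - w) * (z + (w - 1 - of_real (ln 2)) - G)"
    by (simp add: secular_def y_def A_entry_corner algebra_simps)
  moreover have "norm (z + (w - 1 - of_real (ln 2)) - G) \<ge> 1 / 4"
  proof -
    have "norm (w - 1 - of_real (ln 2)) = \<bar>l - 1 - ln 2\<bar>"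
      unfolding w_def by (metis norm_of_real of_real_1 of_real_diff)
    then have 1: "norm (w - 1 - of_real (ln 2)) \<le> 0.47" using l ln2_bounds by simp
    have y_le: "norm (y k) \<le> 0.69" if "k \<ge> 1" for k
    proof -
      have "norm (y k) \<le> (1 / 2) / (norm w - 1 / 2)"
        unfolding y_def using l lw that by (intro norm_row_solve_A_le norm_A_row_le) auto
      also have "\<dots> \<le> 0.69" using l lw by (simp add: field_simps)
      finally show ?thesis .
    qed
    have g_le: "norm (g k) \<le> 1.4" if "k \<ge> 1" for k
    proof -
      have "norm (g k) \<le> 0.69 / (norm z - 1 / 2)"
        unfolding g_def using z that y_le by (intro norm_row_solve_A_le) auto
      also have "\<dots> \<le> 1.4" using z by (simp add: field_simps)
      finally show ?thesis .
    qed
    \<comment> \<open>The uniform bound \<open>1.4\<close> on \<open>g 1\<close> against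
      \<open>|A_entry 2 0|\<close>, about \<open>0.41\<close>, would exhaust the whole margin. So
      the first component is computed exactly as \<open>y 1 / (z + 1/4)\<close>, and the uniform
      bound is kept for \<open>k \<ge> 2\<close>, where column 0 is small.\<close>
    have T11: "A_block 1 1 = - (1 / 4)" by (simp add: A_block_eq)
    have "y 1 = of_real (1 / (4 * l + 1))"
      using row_solve_A_of_real[of l 1, where 'a = complex] row_solve_A_small(1)[of l] l
      by (simp add: y_def w_def)
    then have "norm (y 1) = 1 / (4 * l + 1)" using l by (simp only: norm_of_real) simp
    moreover have "1 / (4 * l + 1) \<le> 0.17" using l by (simp add: pos_divide_le_eq)
    ultimately have y1: "norm (y 1) \<le> 0.17" by simp
    have "norm z \<le> norm (z + 1 / 4) + norm (- (1 / 4) :: complex)"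
      using norm_triangle_ineq[of "z + 1 / 4" "- (1 / 4)"] by simp
    then have z4: "norm (z + 1 / 4) \<ge> 0.752" using z by (simp add: norm_divide)
    have "g 1 = y 1 / (z + 1 / 4)"
      unfolding g_def by (subst row_solve.simps) (simp add: T11[simplified])
    then have "norm (g 1) = norm (y 1) / norm (z + 1 / 4)" by (simp add: norm_divide)
    also have "\<dots> \<le> 0.17 / 0.752" using y1 z4 by (intro frac_le) auto
    finally have g1: "norm (g 1) \<le> 0.23" by simp
    have "norm (g 1 * of_real (A_entry 2 0)) \<le> 0.23 * 0.41"
      unfolding norm_mult using third_tail_1_bounds g1
      by (intro mult_mono) (auto simp: A_entry_first_col_small)
    moreover have "norm (\<Sum>k=2..<m. g k * of_real (A_entry (Suc k) 0)) \<le> 1.4 * (9 / (4 * (real 2)\<^sup>2 * 3 ^ 2))"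
      by (rule norm_sum_row_first_col_le) (use g_le in auto)
    moreover have "G = g 1 * of_real (A_entry 2 0) + (\<Sum>k=2..<m. g k * of_real (A_entry (Suc k) 0))"
      unfolding G_def using m by (subst sum.atLeast_Suc_lessThan) (auto simp: numeral_2_eq_2)
    ultimately have 2: "norm G \<le> 0.2"
      using norm_triangle_ineq[of "g 1 * of_real (A_entry 2 0)" "\<Sum>k=2..<m. g k * of_real (A_entry (Suc k) 0)"]
      by simp
    have "norm z \<le> norm (z + (w - 1 - of_real (ln 2)) - G) + norm (w - 1 - of_real (ln 2)) + norm G"
      using norm_triangle_ineq4[of "z + (w - 1 - of_real (ln 2)) - G + G" "w - 1 - of_real (ln 2)"]
        norm_triangle_ineq[of "z + (w - 1 - of_real (ln 2)) - G" G] by simp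
    then show ?thesis using z 1 2 by simp
  qed
  ultimately show ?thesis
    unfolding w_def[symmetric]
    using mult_left_mono[of "1 / 4" "norm (z + (w - 1 - of_real (ln 2)) - G)" "norm (z - w)"]
    by (simp add: norm_mult)
qed

text \<open>A single lower bound for the characteristic polynomial, linear in the distance to
  \<open>l\<close>, gives everything: roots of modulus at least \<open>1.002\<close> coincide with
  \<open>l\<close>, and \<open>l\<close> cannot be a multiple root. Being single is thus understood
  both as uniqueness in the interval and as algebraic multiplicity one.\<close>

theorem proposition5p5:
  fixes m :: nat
  assumes "m \<ge> 7"
  shows "\<exists>l::real.
    {x \<in> {1.232891 - 0.0007 .. 1.232891 + 0.0007}.
        eigenvalue (A_sub_complex m) (complex_of_real x)} = {l} \<and>
    Polynomial.order (complex_of_real l) (char_poly (A_sub_complex m)) = 1 \<and>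
    (\<forall>z::complex. eigenvalue (A_sub_complex m) z \<and> z \<noteq> complex_of_real l \<longrightarrow> cmod z < 1.002)"
proof -
  obtain l :: real where l: "l \<in> {1.232891 - 0.0007 .. 1.232891 + 0.0007}" "secular m l = 0"
    using secular_root[OF assms] .
  define p where "p = char_poly (A_sub_complex m)"
  have A: "A_sub_complex m \<in> carrier_mat (m + 1) (m + 1)" by (auto simp: A_sub_def)
  note ev = eigenvalue_root_char_poly[OF A, folded p_def]
  have secl: "secular m (complex_of_real l) = 0" using l by (simp add: secular_of_real)
  \<comment> \<open>Each of the \<open>m - 1\<close> diagonal factors has modulus at least
    \<open>1.002 - 1/2\<close>, hence at least \<open>1/2\<close>.\<close>
  have p_ge: "norm (poly p z) \<ge> 1 / 4 * norm (z - of_real l) * (1 / 2) ^ (m - 1)" if "norm z \<ge> 1.002" for z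
  proof -
    have "norm (secular m z) \<ge> 1 / 4 * norm (z - of_real l)"
      using secular_separation[OF that l(1), of m] assms secl by simp
    moreover have "(1 / 2) ^ (m - 1) \<le> norm (\<Prod>k=1..<m. z - of_real (A_block k k))"
    proof -
      have "(1 / 2) ^ (m - 1) = (\<Prod>k=1..<m. 1 / 2 :: real)" by simp
      also have "\<dots> \<le> (\<Prod>k=1..<m. norm (z - of_real (A_block k k)))"
      proof (rule prod_mono)
        fix k assume "k \<in> {1..<m}"
        then have "norm (complex_of_real (A_block k k)) \<le> 1 / 2"
          using abs_A_block_diag_le[of k] by simp
        then show "0 \<le> (1 / 2 :: real) \<and> 1 / 2 \<le> norm (z - of_real (A_block k k))"
          using norm_triangle_ineq2[of z "of_real (A_block k k)"] that by simp
      qed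
      finally show ?thesis by (simp add: prod_norm)
    qed
    ultimately have "1 / 4 * norm (z - of_real l) * (1 / 2) ^ (m - 1)
        \<le> norm (secular m z) * norm (\<Prod>k=1..<m. z - of_real (A_block k k))"
      by (intro mult_mono) auto
    then show ?thesis
      unfolding p_def using char_poly_A_sub[of z m] that assms by (simp add: norm_mult)
  qed
  have root_imp: "z = of_real l" if "poly p z = 0" "norm z \<ge> 1.002" for z
  proof -
    have "(0::real) < (1 / 2) ^ (m - 1)" by simp
    then show ?thesis using p_ge[OF that(2)] that(1) by (auto simp: mult_le_0_iff not_le[symmetric])
  qed
  have root_l: "poly p (of_real l) = 0"
    unfolding p_def using char_poly_A_sub[of "of_real l" m] l secl assms by simp
  have "p \<noteq> 0" unfolding p_def using degree_monic_char_poly[OF A] by auto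
  \<comment> \<open>At \<open>l + t\<close> with real \<open>t > 0\<close>, which stays in the
    region of \<open>p_ge\<close>, a double root makes the polynomial equal to \<open>t^2\<close>
    times \<open>q\<close>, while \<open>p_ge\<close> bounds it below by \<open>c * t\<close>.
    Dividing by \<open>t\<close> and letting \<open>t\<close> tend to 0 forces
    \<open>c \<le> 0\<close>.\<close>
  have "\<not> [:- of_real l, 1:] ^ 2 dvd p"
  proof
    assume "[:- of_real l, 1:] ^ 2 dvd p"
    then obtain q where q: "p = [:- of_real l, 1:] ^ 2 * q" by (auto simp: dvd_def)
    define c where "c = (1 / 4) * (1 / 2 :: real) ^ (m - 1)"
    have lim: "((\<lambda>t. norm (of_real t * poly q (of_real (l + t)))) \<longlongrightarrow> norm (of_real 0 * poly q (of_real (l + 0)))) (at_right 0)"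
      by (intro tendsto_intros)
    have ev: "\<forall>\<^sub>F t in at_right 0. c \<le> norm (of_real t * poly q (of_real (l + t)))"
      using eventually_at_right_less[of "0::real"]
    proof eventually_elim
      case (elim t)
      have "norm (complex_of_real (l + t)) \<ge> 1.002" using l elim unfolding norm_of_real by simp
      have "poly p (of_real (l + t)) = (of_real t)\<^sup>2 * poly q (of_real (l + t))"
        by (simp add: q)
      then have "norm (poly p (of_real (l + t))) = t * (t * norm (poly q (of_real (l + t))))"
        by (simp only: norm_mult norm_power norm_of_real) (simp add: power2_eq_square)
      with p_ge[OF \<open>norm (complex_of_real (l + t)) \<ge> 1.002\<close>]
      have "t * c \<le> t * (t * norm (poly q (of_real (l + t))))"
        using elim by (simp add: c_def mult_ac del: of_real_add) (simp add: mult_ac)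
      then show ?case using elim by (simp add: norm_mult)
    qed
    have "c \<le> norm (of_real 0 * poly q (of_real (l + 0)))"
      by (rule tendsto_lowerbound[OF lim ev]) simp
    moreover have "0 < c" unfolding c_def by (intro mult_pos_pos zero_less_power) simp_all
    ultimately show False by simp
  qed
  then have "Polynomial.order (of_real l) p < 2"
    using \<open>p \<noteq> 0\<close> order_divides[of "of_real l" 2 p] by auto
  moreover have "Polynomial.order (of_real l) p \<noteq> 0" using root_l \<open>p \<noteq> 0\<close> order_root by blast
  ultimately have "Polynomial.order (of_real l) p = 1" by simp
  moreover have "{x \<in> {1.232891 - 0.0007 .. 1.232891 + 0.0007}.
      eigenvalue (A_sub_complex m) (complex_of_real x)} = {l}"
  proof -
    have "x = l" if "x \<in> {1.232891 - 0.0007 .. 1.232891 + 0.0007}" "poly p (complex_of_real x) = 0" for x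
    proof -
      have "norm (complex_of_real x) \<ge> 1.002" using that(1) unfolding norm_of_real by simp
      then show ?thesis using root_imp that(2) by (metis of_real_eq_iff)
    qed
    with l(1) root_l show ?thesis unfolding ev by blast
  qed
  moreover have "\<forall>z. eigenvalue (A_sub_complex m) z \<and> z \<noteq> complex_of_real l \<longrightarrow> cmod z < 1.002"
    using root_imp unfolding ev by (meson not_less)
  ultimately show ?thesis unfolding p_def by blast
qed

end
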